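(* Let $r>p\ge1$, $t\ge p$ and $k\ge1$ be integers. Then there is an integer $N(r,p,t,k)>0$ such that for every $n\ge N(r,p,t,k)$, every orientation $D$ of the complete $r$-uniform hypergraph $H(n,r)$ has a $t$-set $B\subseteq V(H(n,r))$ all of whose $p$-subsets $S$ satisfy $d_i(S)\ge k$ for all $1\le i\le\binom rp$.
   Context: An orientation assigns to each edge a linear ordering of its $r$ vertices (positions $1,\dots,r$). Let $P_1,\dots,P_{\binom rp}$ be the $p$-subsets of $\{1,\dots,r\}$; for a $p$-set $S$, $d_i(S)$ is the number of edges $E\supseteq S$ in which $S$ occupies exactly the positions $P_i$. *)

theory Defs
  imports Main "HOL-Library.Ramsey"
begin

text \<open>The complete \<open>r\<close>-uniform hypergraph on a vertex set \<open>V\<close> has edge set \<^term>\<open>nsets V r\<close>.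
  The values of an orientation outside this set are irrelevant.\<close>

definition orientation :: "'a set \<Rightarrow> nat \<Rightarrow> ('a set \<Rightarrow> 'a rel) \<Rightarrow> bool" where
  "orientation V r D \<longleftrightarrow> (\<forall>E\<in>nsets V r. linear_order_on E (D E))"

text \<open>Orders are reflexive, so on a linearly ordered set of \<open>r\<close> elements the positions
  run from \<open>1\<close> to \<open>r\<close>, with \<open>1\<close> for the least element.\<close>

definition position :: "'a rel \<Rightarrow> 'a \<Rightarrow> nat" where
  "position R v = card {u. (u, v) \<in> R}"

text \<open>The degree of \<open>S\<close> is indexed by the set of positions \<open>P\<close> itself instead of by its number
  in an enumeration of the \<open>p\<close>-subsets of \<^term>\<open>{1..r}\<close>.\<close>

definition position_degree ::
    "'a set \<Rightarrow> nat \<Rightarrow> ('a set \<Rightarrow> 'a rel) \<Rightarrow> nat set \<Rightarrow> 'a set \<Rightarrow> nat" where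
  "position_degree V r D P S = card {E \<in> nsets V r. S \<subseteq> E \<and> position (D E) ` S = P}"

end

theory Submission
  imports Defs
begin

text \<open>Colour each edge by the permutation that relates its order under \<^term>\<open>D\<close> to the natural
  order of its vertices. Ramsey's theorem gives a large vertex set \<^term>\<open>H\<close> on which this
  permutation \<open>\<sigma>\<close> is constant, so there a \<open>p\<close>-set occupies the positions \<open>P\<close> in an edge iff
  its natural ranks in that edge are \<open>\<sigma>\<^sup>-\<^sup>1(P)\<close>. If \<open>B \<subseteq> H\<close> leaves gaps of more than
  \<open>r + k - 2\<close> elements of \<^term>\<open>H\<close> between and around its elements, then every \<open>p\<close>-subset of \<open>B\<close>
  can be given any prescribed ranks in at least \<open>k\<close> ways by filling in vertices from the gaps.\<close>

text \<open>\<open>ramsey_full\<close> speaks of the vertices \<open>{..<N}\<close> and numbered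
  colours. An injection \<open>h\<close> of \<open>{..<N}\<close> into \<open>V\<close> and a
  numbering \<open>idx\<close> of \<open>C\<close> pull a colouring of \<open>V\<close> back to that
  setting, and the image under \<open>h\<close> of the homogeneous set found there is homogeneous in
  \<open>V\<close>.\<close>

lemma partn_finite_colours:
  assumes "finite C"
  shows "\<exists>N::nat. \<forall>V::'a set. finite V \<longrightarrow> card V \<ge> N \<longrightarrow> partn V m \<gamma> C"
proof -
  obtain N :: nat where N: "partn_lst {..<N} (replicate (card C) m) \<gamma>"
    using ramsey_full by blast
  obtain idx where idx: "bij_betw idx C {..<card C}"
    using ex_bij_betw_finite_nat[OF assms] by (auto simp: atLeast0LessThan)
  have "partn V m \<gamma> C" if V: "finite V" "card V \<ge> N" for V :: "'a set"
    unfolding partn_def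
  proof
    fix f assume f: "f \<in> [V]\<^bsup>\<gamma>\<^esup> \<rightarrow> C"
    obtain h where h: "inj_on h {..<N}" "h ` {..<N} \<subseteq> V"
      using card_le_inj[of "{..<N}" V] V by auto
    define F where "F = (\<lambda>X. idx (f (h ` X)))"
    have hX: "h ` X \<in> [V]\<^bsup>j\<^esup>" if "X \<in> [{..<N}]\<^bsup>j\<^esup>" for X j
      using nsets_image_funcset[of h "{..<N}" V j] h that by blast
    have fX: "f (h ` X) \<in> C" if "X \<in> [{..<N}]\<^bsup>\<gamma>\<^esup>" for X
      using hX[OF that] f by auto
    have "F \<in> [{..<N}]\<^bsup>\<gamma>\<^esup> \<rightarrow> {..<card C}"
      unfolding F_def using fX bij_betw_apply[OF idx] by blast
    then obtain i H where i: "i < card C" and H: "H \<in> [{..<N}]\<^bsup>m\<^esup>"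
      and mono: "F ` [H]\<^bsup>\<gamma>\<^esup> \<subseteq> {i}"
      by (rule partn_lstE[OF N]) auto
    obtain c where c: "c \<in> C" "idx c = i"
      using idx i by (metis bij_betw_iff_bijections lessThan_iff)
    have inj: "inj_on h H"
      using h(1) H by (auto simp: nsets_def intro: inj_on_subset)
    have "f Y = c" if Y: "Y \<in> [h ` H]\<^bsup>\<gamma>\<^esup>" for Y
    proof -
      obtain X where X: "X \<in> [H]\<^bsup>\<gamma>\<^esup>" "Y = h ` X"
        using nset_image_obtains[OF Y inj] .
      have "X \<in> [{..<N}]\<^bsup>\<gamma>\<^esup>"
        using X(1) H by (auto simp: nsets_def)
      then have "f Y \<in> C" "idx (f Y) = idx c"
        using fX X mono c(2) by (auto simp: F_def)
      then show ?thesis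
        using idx c(1) by (auto simp: bij_betw_def inj_on_def)
    qed
    then show "\<exists>\<xi>\<in>C. monochromatic V m \<gamma> f \<xi>"
      unfolding monochromatic_def using hX[OF H] c(1) by blast
  qed
  then show ?thesis by blast
qed

text \<open>Transitivity and antisymmetry make the down-set of a smaller element a proper subset of
  that of a larger one. So positions are injective, and counting gives surjectivity.\<close>

lemma position_bij_betw:
  assumes "finite E" "linear_order_on E R"
  shows "bij_betw (position R) E {1..card E}"
proof -
  have R: "R \<subseteq> E \<times> E" "refl_on E R" "trans R" "antisym R" "total_on E R"
    using assms(2) by (auto simp: order_on_defs)
  have fin: "finite {u. (u, v) \<in> R}" for v
    using R(1) assms(1) by (auto intro: finite_subset[of _ E])
  have less: "position R u < position R v" if "(u, v) \<in> R" "u \<noteq> v" for u v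
    unfolding position_def
  proof (rule psubset_card_mono[OF fin])
    have "(v, v) \<in> R" "(v, u) \<notin> R"
      using that R by (auto simp: refl_on_def antisym_def)
    then show "{w. (w, u) \<in> R} \<subset> {w. (w, v) \<in> R}"
      using that R(3) by (auto dest: transD)
  qed
  have inj: "inj_on (position R) E"
    using R(5) less by (metis inj_onI less_irrefl total_on_def)
  have "position R v \<in> {1..card E}" if "v \<in> E" for v
  proof -
    have "v \<in> {u. (u, v) \<in> R}"
      using that R(2) by (auto simp: refl_on_def)
    then have "position R v > 0"
      unfolding position_def using fin by (auto simp: card_gt_0_iff)
    moreover have "position R v \<le> card E"
      unfolding position_def using R(1) assms(1) by (auto intro: card_mono)
    ultimately show ?thesis by simp
  qed
  then have "position R ` E = {1..card E}"
    using inj by (intro card_subset_eq) (auto simp: card_image)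
  then show ?thesis
    using inj by (simp add: bij_betw_def)
qed

lemma strict_mono_on_nth_sorted_list_of_set:
  "strict_mono_on {..<card A} (\<lambda>i. sorted_list_of_set A ! i)"
  by (auto intro!: strict_mono_onI sorted_wrt_nth_less[OF strict_sorted_list_of_set])

lemma image_nth_sorted_list_of_set:
  "finite A \<Longrightarrow> (\<lambda>i. sorted_list_of_set A ! i) ` {..<card A} = A"
  using set_conv_nth[of "sorted_list_of_set A"] by (auto simp: image_def)

lemma sorted_list_of_set_image_strict_mono:
  assumes "strict_mono_on {..<r} g"
  shows "sorted_list_of_set (g ` {..<r}) = map g [0..<r]"
proof -
  have "sorted_wrt (<) (map g [0..<r])"
    using assms by (auto simp: sorted_wrt_iff_nth_less strict_mono_on_def)
  then show ?thesis
    by (intro strict_sorted_equal) (auto simp: atLeast0LessThan)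
qed

text \<open>Ranks outside \<^term>\<open>Q\<close> are realised in the gap following the image of their
  predecessor in \<^term>\<open>Q\<close>, shifted by \<^term>\<open>i\<close>; gaps have room since
  \<^term>\<open>S\<close> consists of positive multiples of \<^term>\<open>L\<close>.\<close>

lemma spread_extensions:
  fixes Q S :: "nat set"
  assumes Q: "Q \<subset> {..<r}" and S: "S \<subseteq> (\<lambda>j. L * Suc j) ` {..<t}"
    and card: "card Q = card S" and L: "r + k \<le> L"
  obtains g :: "nat \<Rightarrow> nat \<Rightarrow> nat"
  where "\<And>i. i < k \<Longrightarrow> strict_mono_on {..<r} (g i)"
    and "\<And>i. i < k \<Longrightarrow> g i ` {..<r} \<subseteq> {..<L * Suc t}"
    and "\<And>i. i < k \<Longrightarrow> g i ` Q = S"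
    and "inj_on (\<lambda>i. g i ` {..<r}) {..<k}"
proof -
  have fQ: "finite Q" and fS: "finite S"
    using Q S by (auto intro: finite_subset[OF psubset_imp_subset] finite_subset)
  obtain a where a: "bij_betw a {..<card Q} Q" "strict_mono_on {..<card Q} a"
    using strict_mono_on_nth_sorted_list_of_set[of Q] image_nth_sorted_list_of_set[OF fQ]
    by (metis bij_betw_imageI strict_mono_on_imp_inj_on)
  obtain b where b: "b ` {..<card Q} = S" "strict_mono_on {..<card Q} b"
    using strict_mono_on_nth_sorted_list_of_set[of S] image_nth_sorted_list_of_set[OF fS]
    by (metis card)
  \<comment> \<open>The order isomorphism from \<open>Q\<close> to \<open>S\<close>: elements of
    equal rank correspond.\<close>
  define \<phi> where "\<phi> = b \<circ> inv_into {..<card Q} a"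
  have \<phi>S: "\<phi> ` Q = S"
    unfolding \<phi>_def image_comp[symmetric] using a(1) b(1)
    by (metis bij_betw_def bij_betw_inv_into)
  have \<phi>mono: "\<phi> x < \<phi> y" if "x \<in> Q" "y \<in> Q" "x < y" for x y
  proof -
    obtain u v where uv: "u < card Q" "v < card Q" "x = a u" "y = a v"
      using \<open>x \<in> Q\<close> \<open>y \<in> Q\<close> bij_betw_imp_surj_on[OF a(1)]
      by (metis imageE lessThan_iff)
    moreover have "u < v"
      using uv that(3) a(2) by (metis lessThan_iff linorder_neqE_nat order_less_asym strict_mono_onD)
    ultimately show ?thesis
      using a(1) b(2) by (simp add: \<phi>_def bij_betw_def strict_mono_on_def inv_into_f_f)
  qed
  \<comment> \<open>The default \<open>0\<close> serves those \<open>j\<close> that have no element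
    of \<open>Q\<close> at or below them; they are placed in the gap between \<open>0\<close> and
    \<open>L\<close>.\<close>
  define base where "base j = Max (insert 0 (\<phi> ` {q \<in> Q. q \<le> j}))" for j
  \<comment> \<open>In the offset, \<open>j\<close> keeps ranks with a common base in order,
    \<open>i\<close> separates the \<open>k\<close> extensions, and \<open>Suc\<close> avoids the
    base itself. For \<open>j < r\<close> and \<open>i < k\<close> it is at most
    \<open>r + k - 1\<close>, hence below \<open>L\<close>.\<close>
  define g where "g i j = base j + (if j \<in> Q then 0 else Suc (j + i))" for i j
  have base_in: "base j \<in> insert 0 S" for j
    unfolding base_def using Max_in[of "insert 0 (\<phi> ` {q \<in> Q. q \<le> j})"] fQ \<phi>S by auto
  have base_mult: "\<exists>c\<le>t. base j = L * c" for j
  proof (cases "base j = 0")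
    case False
    then have "base j \<in> (\<lambda>j. L * Suc j) ` {..<t}"
      using base_in[of j] S by (metis insertE subsetD)
    then show ?thesis
      by (metis Suc_leI imageE lessThan_iff)
  qed (metis mult_0_right zero_le)
  have base_Q: "base q = \<phi> q" if "q \<in> Q" for q
    unfolding base_def using that fQ \<phi>mono
    by (intro Max_eqI) (auto simp: le_less)
  have base_mono: "base j \<le> base j'" if "j \<le> j'" for j j'
    unfolding base_def using that fQ by (intro Max_mono) auto
  have offset: "(if j \<in> Q then 0 else Suc (j + i)) < L" if "j < r" "i < k" for i j
    using that L by auto
  have g_mono: "strict_mono_on {..<r} (g i)" if i: "i < k" for i
  proof (rule strict_mono_onI)
    fix j j' assume jj: "j \<in> {..<r}" "j' \<in> {..<r}" "j < j'"
    show "g i j < g i j'"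
    \<comment> \<open>With equal bases, \<open>j'\<close> lies outside \<open>Q\<close>, since an
      element of \<open>Q\<close> would start a new base, and the offsets decide. Distinct bases are
      multiples of \<open>L\<close>, so they differ by more than any offset.\<close>
    proof (cases "base j = base j'")
      case True
      have "j' \<notin> Q"
      proof
        assume j': "j' \<in> Q"
        have "\<phi> j' \<in> S"
          using \<phi>S j' by blast
        \<comment> \<open>Here \<open>offset\<close> supplies \<open>L > 0\<close>, so that the
          elements of \<open>S\<close> are positive and exceed the default \<open>0\<close>.\<close>
        then have "\<phi> j' > 0"
          using S offset[of j i] i jj(1) by (auto split: if_splits)
        moreover have "\<phi> q < \<phi> j'" if "q \<in> Q" "q \<le> j" for q
          using \<phi>mono that j' jj(3) by auto
        ultimately have "base j < \<phi> j'"
          unfolding base_def using fQ by (subst Max_less_iff) auto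
        then show False
          using True base_Q[OF j'] by simp
      qed
      then show ?thesis
        using True jj(3) by (simp add: g_def)
    next
      case False
      obtain c c' where c: "base j = L * c" "base j' = L * c'"
        using base_mult by metis
      have "L * c < L * c'"
        using False base_mono[of j j'] jj(3) c by linarith
      then have "L * Suc c \<le> L * c'"
        by (metis Suc_leI mult_le_mono2 mult_less_cancel1)
      then show ?thesis
        using c offset[of j i] jj i by (simp add: g_def)
    qed
  qed
  have "g i j < L * Suc t" if "j < r" "i < k" for i j
  proof -
    obtain c where "c \<le> t" "base j = L * c"
      using base_mult by blast
    then have "base j \<le> L * t" by simp
    then show ?thesis
      using offset[OF that] by (simp add: g_def)
  qed
  then have g_bound: "g i ` {..<r} \<subseteq> {..<L * Suc t}" if "i < k" for i
    using that by auto
  have g_Q: "g i ` Q = S" for i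
    using base_Q \<phi>S by (force simp: g_def)
  \<comment> \<open>The vertex sum tells the images apart: raising \<open>i\<close> lowers no value
    and raises the one at some rank outside \<open>Q\<close>, which exists because \<open>Q\<close>
    is a proper subset.\<close>
  have "\<Sum>(g i ` {..<r}) < \<Sum>(g i' ` {..<r})" if "i < i'" "i' < k" for i i'
  proof -
    have "inj_on (g i) {..<r}" "inj_on (g i') {..<r}"
      using g_mono that by (meson order.strict_trans strict_mono_on_imp_inj_on)+
    moreover have "(\<Sum>j<r. g i j) < (\<Sum>j<r. g i' j)"
    proof (rule sum_strict_mono_ex1)
      show "\<exists>j\<in>{..<r}. g i j < g i' j"
        using Q that by (auto simp: g_def)
    qed (use that in \<open>auto simp: g_def\<close>)
    ultimately show ?thesis
      by (simp add: sum.reindex)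
  qed
  then have "inj_on (\<lambda>i. g i ` {..<r}) {..<k}"
    by (intro linorder_inj_onI') (metis lessThan_iff less_irrefl)
  then show ?thesis
    using that[of g] g_mono g_bound g_Q by blast
qed

text \<open>The permutation used as the colour of an edge, from natural ranks counted from 0 to
  positions counted from 1. \<open>restrict\<close> fixes its values elsewhere, so that only
  finitely many colours occur.\<close>

definition order_pattern :: "nat \<Rightarrow> ('a::linorder set \<Rightarrow> 'a rel) \<Rightarrow> 'a set \<Rightarrow> nat \<Rightarrow> nat" where
  "order_pattern r D E = restrict (\<lambda>j. position (D E) (sorted_list_of_set E ! j)) {..<r}"

lemma order_pattern_bij_betw:
  assumes "E \<in> [V]\<^bsup>r\<^esup>" "orientation V r D"
  shows "bij_betw (order_pattern r D E) {..<r} {1..r}"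
proof -
  have E: "finite E" "card E = r"
    using assms(1) by (auto simp: nsets_def)
  have "bij_betw (\<lambda>j. sorted_list_of_set E ! j) {..<r} E"
    using strict_mono_on_nth_sorted_list_of_set[of E] image_nth_sorted_list_of_set[OF E(1)] E(2)
    by (metis bij_betw_imageI strict_mono_on_imp_inj_on)
  moreover have "bij_betw (position (D E)) E {1..r}"
    using position_bij_betw[OF E(1)] assms E(2) by (auto simp: orientation_def)
  ultimately have "bij_betw (position (D E) \<circ> (\<lambda>j. sorted_list_of_set E ! j)) {..<r} {1..r}"
    by (rule bij_betw_trans)
  then show ?thesis
    by (rule bij_betw_cong[THEN iffD1, rotated]) (simp add: order_pattern_def)
qed

text \<open>An increasing enumeration \<open>g\<close> of an edge is its sorted list, so
  \<open>g j\<close> is the vertex of rank \<open>j\<close>.\<close>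

lemma position_strict_mono_image:
  assumes "strict_mono_on {..<r} g" "j < r"
  shows "position (D (g ` {..<r})) (g j) = order_pattern r D (g ` {..<r}) j"
  using assms by (simp add: order_pattern_def sorted_list_of_set_image_strict_mono)

theorem theorem13:
  fixes r p t k :: nat
  assumes "p \<ge> 1" and "r > p" and "t \<ge> p" and "k \<ge> 1"
  shows "\<exists>N>0. \<forall>n\<ge>N. \<forall>D. orientation {1..n::nat} r D \<longrightarrow>
    (\<exists>B\<in>nsets {1..n} t. \<forall>S\<in>nsets B p. \<forall>P\<in>nsets {1..r} p.
      position_degree {1..n} r D P S \<ge> k)"
proof -
  define L where "L = r + k"
  \<comment> \<open>Room for the \<open>t\<close> marks \<open>L, 2 * L, ..., t * L\<close> with a
    gap before the first and after each.\<close>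
  define m where "m = L * Suc t"
  define C where "C = PiE {..<r} (\<lambda>_. {1..r})"
  have "finite C"
    by (simp add: C_def finite_PiE)
  then obtain N where N: "\<And>V::nat set. finite V \<Longrightarrow> card V \<ge> N \<Longrightarrow> partn V m r C"
    using partn_finite_colours by blast
  \<comment> \<open>\<open>Suc N\<close> in place of \<open>N\<close> makes the threshold
    positive.\<close>
  have "\<exists>B\<in>[{1..n}]\<^bsup>t\<^esup>. \<forall>S\<in>[B]\<^bsup>p\<^esup>. \<forall>P\<in>[{1..r}]\<^bsup>p\<^esup>. k \<le> position_degree {1..n} r D P S"
    if n: "n \<ge> Suc N" and D: "orientation {1..n} r D" for n :: nat and D
  proof -
    have "order_pattern r D E \<in> C" if "E \<in> [{1..n}]\<^bsup>r\<^esup>" for E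
      unfolding C_def
    proof (rule PiE_I)
      fix j assume "j \<in> {..<r}"
      then show "order_pattern r D E j \<in> {1..r}"
        by (rule bij_betw_apply[OF order_pattern_bij_betw[OF that D]])
    qed (simp add: order_pattern_def)
    then have "order_pattern r D \<in> [{1..n}]\<^bsup>r\<^esup> \<rightarrow> C"
      by (rule Pi_I)
    then obtain \<sigma> H where H: "H \<in> [{1..n}]\<^bsup>m\<^esup>" and
      \<sigma>: "\<And>E. E \<in> [H]\<^bsup>r\<^esup> \<Longrightarrow> order_pattern r D E = \<sigma>"
      using N[of "{1..n}"] n by (fastforce simp: partn_def monochromatic_def)
    have H': "finite H" "card H = m" "H \<subseteq> {1..n}"
      using H by (auto simp: nsets_def)
    \<comment> \<open>The increasing enumeration of \<open>H\<close> moves the choice of vertices to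
      the indices \<open>{..<m}\<close>, where gaps are plain differences.\<close>
    define e where "e i = sorted_list_of_set H ! i" for i
    have e_mono: "strict_mono_on {..<m} e" and e_img: "e ` {..<m} = H"
      using strict_mono_on_nth_sorted_list_of_set[of H] image_nth_sorted_list_of_set[of H] H'
      by (simp_all add: e_def[abs_def])
    have e_inj: "inj_on e {..<m}"
      using e_mono by (rule strict_mono_on_imp_inj_on)
    \<comment> \<open>Some edge thus lies inside \<open>H\<close>, and \<open>\<sigma>\<close>,
      being its pattern, is a bijection.\<close>
    have "r \<le> m" by (simp add: m_def L_def)
    then obtain E\<^sub>0 where "E\<^sub>0 \<in> [H]\<^bsup>r\<^esup>"
      using nsets_eq_empty_iff[of H r] H' by fastforce
    then have \<sigma>_bij: "bij_betw \<sigma> {..<r} {1..r}"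
      using order_pattern_bij_betw[OF _ D] \<sigma> nsets_mono[OF H'(3)] by blast
    have "L > 0"
      using assms by (simp add: L_def)
    define B' where "B' = (\<lambda>j. L * Suc j) ` {..<t}"
    have B'_sub: "B' \<subseteq> {..<m}"
      using \<open>L > 0\<close> by (auto simp: B'_def m_def simp del: mult_Suc_right)
    have "card B' = t"
      unfolding B'_def using \<open>L > 0\<close> by (subst card_image) (auto simp: inj_on_def)
    then have "e ` B' \<in> [{1..n}]\<^bsup>t\<^esup>"
      using B'_sub e_img e_inj H'(3)
      by (auto simp: nsets_def B'_def card_image inj_on_subset)
    moreover have "k \<le> position_degree {1..n} r D P S"
      if S: "S \<in> [e ` B']\<^bsup>p\<^esup>" and P: "P \<in> [{1..r}]\<^bsup>p\<^esup>" for S P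
    proof -
      obtain S' where S': "S' \<in> [B']\<^bsup>p\<^esup>" "S = e ` S'"
        using nset_image_obtains[OF S inj_on_subset[OF e_inj B'_sub]] .
      \<comment> \<open>The ranks that \<open>\<sigma>\<close> sends to \<open>P\<close>. As
        \<open>p < r\<close>, at least one rank remains free for varying the edge.\<close>
      define Q where "Q = {j \<in> {..<r}. \<sigma> j \<in> P}"
      have \<sigma>Q: "\<sigma> ` Q = P"
        using \<sigma>_bij P by (auto simp: Q_def nsets_def bij_betw_def)
      have "inj_on \<sigma> Q"
        using \<sigma>_bij by (auto simp: Q_def bij_betw_def intro: inj_on_subset)
      then have "card Q = p"
        using \<sigma>Q P card_image by (force simp: nsets_def)
      then have "Q \<subset> {..<r}" "card Q = card S'"
        using assms(2) S' by (auto simp: Q_def nsets_def)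
      moreover have "S' \<subseteq> (\<lambda>j. L * Suc j) ` {..<t}"
        using S'(1) by (simp add: nsets_def B'_def)
      ultimately obtain g where g_mono: "\<And>i. i < k \<Longrightarrow> strict_mono_on {..<r} (g i)"
        and g_bound: "\<And>i. i < k \<Longrightarrow> g i ` {..<r} \<subseteq> {..<m}"
        and g_Q: "\<And>i. i < k \<Longrightarrow> g i ` Q = S'"
        and g_inj: "inj_on (\<lambda>i. g i ` {..<r}) {..<k}"
        using spread_extensions[of Q r S' L t k] by (auto simp: m_def L_def)
      \<comment> \<open>The \<open>k\<close> edges to be counted: in \<open>F i\<close> the set
        \<open>S\<close> has the ranks \<open>Q\<close>, and the pattern there is
        \<open>\<sigma>\<close>, so \<open>S\<close> occupies the positions
        \<open>P\<close>.\<close>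
      define F where "F i = (e \<circ> g i) ` {..<r}" for i
      define T where "T = {E \<in> [{1..n}]\<^bsup>r\<^esup>. S \<subseteq> E \<and> position (D E) ` S = P}"
      have "F i \<in> T" if i: "i < k" for i
      proof -
        have eg: "strict_mono_on {..<r} (e \<circ> g i)"
          using e_mono g_mono[OF i] g_bound[OF i]
          by (auto simp: strict_mono_on_def image_subset_iff)
        then have "card (F i) = r"
          unfolding F_def by (metis card_image card_lessThan strict_mono_on_imp_inj_on)
        then have F: "F i \<in> [H]\<^bsup>r\<^esup>"
          using g_bound[OF i] e_img by (auto simp: F_def nsets_def)
        have S_eq: "S = (e \<circ> g i) ` Q"
          using S'(2) g_Q[OF i] by (metis image_comp)
        have "position (D (F i)) ((e \<circ> g i) j) = \<sigma> j" if "j \<in> Q" for j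
          using position_strict_mono_image[OF eg, of j D] that \<sigma>[OF F] by (simp add: F_def Q_def)
        then have "position (D (F i)) ` S = \<sigma> ` Q"
          unfolding S_eq image_comp by (intro image_cong) auto
        moreover have "S \<subseteq> F i"
          unfolding S_eq F_def Q_def by auto
        ultimately show ?thesis
          using F nsets_mono[OF H'(3)] \<sigma>Q by (auto simp: T_def)
      qed
      moreover have "inj_on F {..<k}"
      proof (rule inj_onI)
        fix i i' assume i: "i \<in> {..<k}" "i' \<in> {..<k}" "F i = F i'"
        then have "e ` (g i ` {..<r}) = e ` (g i' ` {..<r})"
          by (simp add: F_def image_comp)
        then have "g i ` {..<r} = g i' ` {..<r}"
          using inj_on_image_eq_iff[OF e_inj] g_bound i by simp
        then show "i = i'"
          using g_inj i by (auto dest: inj_onD)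
      qed
      moreover have "finite T"
        by (simp add: T_def finite_imp_finite_nsets)
      ultimately have "card {..<k} \<le> card T"
        by (intro card_inj_on_le[of F]) auto
      then show ?thesis
        by (simp add: position_degree_def T_def)
    qed
    ultimately show ?thesis by blast
  qed
  then show ?thesis
    by (intro exI[of _ "Suc N"]) blast
qed

end
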